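(* Let $S$ be a geometric numerical semigroup, i.e. $S=\langle a^k, a^{k-1}b,\dots,b^k\rangle$ for some positive integers $a,b,k$ with $\gcd(a,b)=1$. Then at least one of $a$ and $b$ is odd, and \[ O(G(S))-E(G(S)) = \begin{cases} 0 & \text{if both } a \text{ and } b \text{ are odd},\\[1mm] \dfrac{a^k-1}{2} & \text{if } a \text{ is odd and } b \text{ is even},\\[2mm] \dfrac{b^k-1}{2} & \text{if } a \text{ is even and } b \text{ is odd}.\end{cases} \]
   Context: $\mathbb{N}_0$ denotes the set of nonnegative integers. A numerical semigroup $S$ is a submonoid of $(\mathbb{N}_0,+)$ with finite complement; $G(S)=\mathbb{N}_0\setminus S$ is its (finite) set of gaps. For positive integers $n_1,\dots,n_r$, $\langle n_1,\dots,n_r\rangle$ is the set of all $\mathbb{N}_0$-linear combinations of $n_1,\dots,n_r$; it is a numerical semigroup iff $\gcd(n_1,\dots,n_r)=1$. The generators here are $a^{k-i}b^i$ for $0\le i\le k$, whose gcd is $1$ iff $\gcd(a,b)=1$. For a finite set $X$ of integers, $O(X)$ (resp. $E(X)$) is the number of odd (resp. even) integers in $X$. *)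

theory Defs
  imports Complex_Main
begin

definition numerical_semigroup :: "nat set \<Rightarrow> bool" where
  "numerical_semigroup S \<longleftrightarrow>
     0 \<in> S \<and> (\<forall>x\<in>S. \<forall>y\<in>S. x + y \<in> S) \<and> finite (- S)"

definition gaps :: "nat set \<Rightarrow> nat set" where
  "gaps S = - S"

definition semigroup_gen :: "nat list \<Rightarrow> nat set" where
  "semigroup_gen ns = {\<Sum>i<length ns. c i * ns ! i | c :: nat \<Rightarrow> nat. True}"

definition geometric_gens :: "nat \<Rightarrow> nat \<Rightarrow> nat \<Rightarrow> nat list" where
  "geometric_gens a b k = map (\<lambda>i. a ^ (k - i) * b ^ i) [0..<Suc k]"

(* That S is a numerical semigroup is not part of the definition: it follows from coprimality,
   see geometric_numerical_semigroup_imp_numerical_semigroup below.  In particular the gaps are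
   finite in number, so the cardinalities taken of sets of gaps are genuine. *)
definition geometric_numerical_semigroup :: "nat \<Rightarrow> nat \<Rightarrow> nat \<Rightarrow> nat set \<Rightarrow> bool" where
  "geometric_numerical_semigroup a b k S \<longleftrightarrow>
     a > 0 \<and> b > 0 \<and> k > 0 \<and> coprime a b \<and> S = semigroup_gen (geometric_gens a b k)"

definition odd_count :: "'a::semiring_parity set \<Rightarrow> nat" where
  "odd_count X = card {x \<in> X. odd x}"

definition even_count :: "'a::semiring_parity set \<Rightarrow> nat" where
  "even_count X = card {x \<in> X. even x}"

lemma semigroup_gen_zero: "0 \<in> semigroup_gen ns"
  unfolding semigroup_gen_def by (auto intro!: exI[of _ "\<lambda>_. 0"])

lemma semigroup_gen_add:
  assumes "x \<in> semigroup_gen ns" "y \<in> semigroup_gen ns"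
  shows "x + y \<in> semigroup_gen ns"
proof -
  obtain c d where "x = (\<Sum>i<length ns. c i * ns ! i)" "y = (\<Sum>i<length ns. d i * ns ! i)"
    using assms unfolding semigroup_gen_def by blast
  then have "x + y = (\<Sum>i<length ns. (c i + d i) * ns ! i)"
    by (simp add: sum.distrib distrib_right)
  then show ?thesis
    unfolding semigroup_gen_def by (auto intro!: exI[of _ "\<lambda>i. c i + d i"])
qed

lemma semigroup_gen_mult:
  assumes "i < length ns"
  shows "m * ns ! i \<in> semigroup_gen ns"
proof -
  have "m * ns ! i = (\<Sum>j<length ns. (if j = i then m else 0) * ns ! j)"
    using assms by (simp add: if_distrib[of "\<lambda>z. z * _"] cong: if_cong)
  then show ?thesis
    unfolding semigroup_gen_def by (auto intro!: exI[of _ "\<lambda>j. if j = i then m else 0"])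
qed

lemma coprime_combination:
  fixes x y n :: nat
  assumes "coprime x y" "x > 0" "n \<ge> x * y"
  shows "\<exists>u v. n = u * x + v * y"
proof (cases "y = 0")
  case True
  then have "x = 1" using assms(1) by simp
  then show ?thesis by (intro exI[of _ n] exI[of _ 0]) simp
next
  case False
  obtain p q where pq: "y * p = x * q + 1"
    using bezout_nat[of y x] assms(1) False
    by (auto simp: gcd.commute coprime_iff_gcd_eq_1)
  define v where "v = (p * n) mod x"
  have vy: "v * y \<le> n"
  proof -
    have "v * y \<le> x * y" using assms(2) by (simp add: v_def less_imp_le)
    then show ?thesis using assms(3) by linarith
  qed
  have "v * y mod x = (y * p * n) mod x"
    unfolding v_def by (metis mod_mult_left_eq mult.assoc mult.commute)
  also have "\<dots> = n mod x"
  proof -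
    have "y * p * n = x * (q * n) + n" unfolding pq by (simp add: algebra_simps)
    then show ?thesis by simp
  qed
  finally have "x dvd n - v * y" using vy by (metis mod_eq_dvd_iff_nat)
  then obtain u where "n - v * y = x * u" by (elim dvdE)
  then have "n = u * x + v * y" using vy by (simp add: mult.commute)
  then show ?thesis by blast
qed

lemma geometric_numerical_semigroup_imp_numerical_semigroup:
  assumes "geometric_numerical_semigroup a b k S"
  shows "numerical_semigroup S"
proof -
  let ?ns = "geometric_gens a b k"
  have S: "S = semigroup_gen ?ns" and ab: "a > 0" "coprime a b"
    using assms by (auto simp: geometric_numerical_semigroup_def)
  have len: "length ?ns = Suc k" by (simp add: geometric_gens_def)
  have n0: "?ns ! 0 = a ^ k" and nk: "?ns ! k = b ^ k"
    by (simp_all add: geometric_gens_def nth_append del: upt_Suc)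
  have "n \<in> S" if "n \<ge> a ^ k * b ^ k" for n
  proof -
    have "coprime (a ^ k) (b ^ k)" "a ^ k > 0" using ab by simp_all
    from coprime_combination[OF this that]
    obtain u v where "n = u * a ^ k + v * b ^ k" by blast
    moreover have "u * a ^ k \<in> S" using semigroup_gen_mult[of 0 ?ns u] len n0 S by simp
    moreover have "v * b ^ k \<in> S" using semigroup_gen_mult[of k ?ns v] len nk S by simp
    ultimately show ?thesis using semigroup_gen_add S by simp
  qed
  then have "- S \<subseteq> {..<a ^ k * b ^ k}" by (meson ComplD lessThan_iff not_le subsetI)
  then have "finite (- S)" by (rule finite_subset) simp
  then show ?thesis
    using S semigroup_gen_zero semigroup_gen_add by (simp add: numerical_semigroup_def)
qed

end

theory Submission
  imports Defs
begin

text \<open>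
  Let \<open>A\<close> be the Apery set of \<open>S\<close> with respect to an odd \<open>m \<in> S\<close>, i.e. the least elements of \<open>S\<close> in
  the residue classes modulo \<open>m\<close>.  The gaps in the class of \<open>w \<in> A\<close> are \<open>w mod m + j m\<close> with
  \<open>j < w div m\<close>; their signs alternate and add up to \<open>((-1)\<^sup>r - (-1)\<^sup>w) / 2\<close> for \<open>r = w mod m\<close>.
  Summing over \<open>w\<close>, twice the alternating sum over all gaps is \<open>1 - (\<Sum>w\<in>A. (-1)\<^sup>w)\<close>.
  For the geometric semigroup with \<open>a\<close> odd and \<open>m = a\<^sup>k\<close>, the Apery set consists of the sums of
  \<open>c\<^sub>i a\<^bsup>k-i\<^esup> b\<^sup>i\<close> over \<open>1 \<le> i \<le> k\<close>, \<open>0 \<le> c\<^sub>i < a\<close>, so its alternating sum factors and equals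
  \<open>a\<^sup>k\<close> or \<open>1\<close> according to the parity of \<open>b\<close>.  The case of even \<open>a\<close> follows by exchanging
  \<open>a\<close> and \<open>b\<close>.
\<close>

section \<open>Apery sets and alternating sums over gaps\<close>

text \<open>Minimality of each \<open>w\<close> in its residue class is not stated but follows:
  \<open>A\<close> meets every class once, and \<open>S\<close> consists of upward shifts of
  \<open>A\<close> by multiples of \<open>m\<close>.\<close>

definition apery_set :: "nat set \<Rightarrow> nat \<Rightarrow> nat set \<Rightarrow> bool" where
  "apery_set S m A \<longleftrightarrow>
     bij_betw (\<lambda>w. w mod m) A {..<m} \<and> S = {w + j * m | w j. w \<in> A}"

lemma sum_alternating_lessThan:
  "2 * (\<Sum>j<q. (-1::int) ^ j) = 1 - (-1) ^ q"
  by (induction q) auto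

text \<open>In the class of \<open>w\<close>, membership in \<open>S\<close> amounts to being at
  least \<open>w\<close>, so the gaps are the numbers with the same remainder and a smaller quotient
  by \<open>m\<close>.\<close>

lemma compl_eq_Union_apery:
  assumes "apery_set S m A" "m > 0"
  shows "- S = (\<Union>w\<in>A. (\<lambda>j. w mod m + j * m) ` {..<w div m})"
proof -
  have bij: "bij_betw (\<lambda>w. w mod m) A {..<m}" and S: "S = {w + j * m | w j. w \<in> A}"
    using assms(1) by (auto simp: apery_set_def)
  show ?thesis
  proof (intro equalityI subsetI)
    fix n assume n: "n \<in> - S"
    have "n mod m \<in> (\<lambda>w. w mod m) ` A"
      using bij assms(2) by (simp add: bij_betw_def)
    then obtain w where w: "w \<in> A" "n mod m = w mod m" by auto
    have "n div m < w div m"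
    proof (rule ccontr)
      assume "\<not> n div m < w div m"
      then obtain d where d: "n div m = w div m + d" by (metis le_Suc_ex not_less)
      have "n = w div m * m + w mod m + d * m"
        using div_mult_mod_eq[of n m] w(2) d by (simp add: algebra_simps)
      then have "n = w + d * m" by simp
      then show False using n w(1) S by blast
    qed
    moreover have "n = w mod m + (n div m) * m"
      using w(2) by (metis add.commute div_mult_mod_eq)
    ultimately show "n \<in> (\<Union>w\<in>A. (\<lambda>j. w mod m + j * m) ` {..<w div m})"
      using w(1) by blast
  next
    fix n assume "n \<in> (\<Union>w\<in>A. (\<lambda>j. w mod m + j * m) ` {..<w div m})"
    then obtain w j where w: "w \<in> A" "j < w div m" "n = w mod m + j * m" by auto
    show "n \<in> - S"
    proof
      assume "n \<in> S"
      then obtain w' j' where w': "w' \<in> A" "n = w' + j' * m" using S by blast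
      have "w mod m = w' mod m"
        using w(3) w'(2) by (metis mod_mod_trivial mod_mult_self1)
      then have "w = w'" using bij w(1) w'(1) by (auto simp: bij_betw_def inj_on_def)
      then have "w \<le> n" using w'(2) by simp
      moreover have "n div m = j" using w(3) assms(2) by simp
      ultimately show False using w(2) div_le_mono[of w n m] by simp
    qed
  qed
qed

lemma alternating_sum_gaps_apery:
  assumes "apery_set S m A" "odd m"
  shows "2 * (\<Sum>n\<in>gaps S. (-1::int) ^ n) = 1 - (\<Sum>w\<in>A. (-1) ^ w)"
proof -
  have m: "m > 0" using assms(2) by (cases m) auto
  have bij: "bij_betw (\<lambda>w. w mod m) A {..<m}"
    using assms(1) by (auto simp: apery_set_def)
  have fin: "finite A" using bij_betw_finite[OF bij] by simp
  have per_class: "2 * (\<Sum>n\<in>(\<lambda>j. w mod m + j * m) ` {..<w div m}. (-1::int) ^ n)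
      = (-1) ^ (w mod m) - (-1) ^ w" for w
  proof -
    \<comment> \<open>Oddness of \<open>m\<close> enters here: each shift by \<open>m\<close> flips
      the sign.\<close>
    have odd_pow: "(-1::int) ^ (x + j * m) = (-1) ^ x * (-1) ^ j" for x j
      using assms(2) by (simp add: power_add power_mult mult.commute[of j] uminus_power_if)
    have "(\<Sum>n\<in>(\<lambda>j. w mod m + j * m) ` {..<w div m}. (-1::int) ^ n)
      = (\<Sum>j<w div m. (-1) ^ (w mod m + j * m))"
      using m by (subst sum.reindex) (auto simp: inj_on_def)
    also have "\<dots> = (-1) ^ (w mod m) * (\<Sum>j<w div m. (-1) ^ j)"
      by (simp only: odd_pow sum_distrib_left)
    finally have "2 * (\<Sum>n\<in>(\<lambda>j. w mod m + j * m) ` {..<w div m}. (-1::int) ^ n)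
      = (-1) ^ (w mod m) * (2 * (\<Sum>j<w div m. (-1) ^ j))"
      by simp
    also have "\<dots> = (-1) ^ (w mod m) - (-1) ^ (w mod m) * (-1) ^ (w div m)"
      by (simp only: sum_alternating_lessThan right_diff_distrib mult_1_right)
    \<comment> \<open>\<open>odd_pow\<close> backwards, with \<open>x = w mod m\<close> and
      \<open>j = w div m\<close>, so that the exponent recombines to \<open>w\<close>.\<close>
    also have "(-1::int) ^ (w mod m) * (-1) ^ (w div m) = (-1) ^ w"
      by (simp only: odd_pow[symmetric]) simp
    finally show ?thesis .
  qed
  have "(\<Sum>n\<in>gaps S. (-1::int) ^ n)
      = (\<Sum>w\<in>A. \<Sum>n\<in>(\<lambda>j. w mod m + j * m) ` {..<w div m}. (-1) ^ n)"
    unfolding gaps_def compl_eq_Union_apery[OF assms(1) m]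
  proof (intro sum.UNION_disjoint fin ballI impI)
    fix w w' assume w: "w \<in> A" "w' \<in> A" "w \<noteq> w'"
    then have "w mod m \<noteq> w' mod m" using bij by (auto simp: bij_betw_def inj_on_def)
    then show "(\<lambda>j. w mod m + j * m) ` {..<w div m} \<inter> (\<lambda>j. w' mod m + j * m) ` {..<w' div m} = {}"
      by (metis (no_types, lifting) disjoint_iff imageE mod_mod_trivial mod_mult_self1)
  qed simp
  then have "2 * (\<Sum>n\<in>gaps S. (-1::int) ^ n) = (\<Sum>w\<in>A. (-1) ^ (w mod m)) - (\<Sum>w\<in>A. (-1) ^ w)"
    by (simp only: sum_distrib_left[of _ _ A] per_class sum_subtractf)
  also have "(\<Sum>w\<in>A. (-1::int) ^ (w mod m)) = (\<Sum>r<m. (-1) ^ r)"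
    by (rule sum.reindex_bij_betw[OF bij])
  also have "\<dots> = 1"
    using sum_alternating_lessThan[of m] assms(2) by simp
  finally show ?thesis .
qed

section \<open>Symmetry and recursion of geometric semigroups\<close>

lemma semigroup_gen_geometric_gens:
  "semigroup_gen (geometric_gens a b k) = {\<Sum>i\<le>k. c i * (a ^ (k - i) * b ^ i) | c. True}"
proof -
  have "(\<Sum>i<length (geometric_gens a b k). c i * geometric_gens a b k ! i)
      = (\<Sum>i\<le>k. c i * (a ^ (k - i) * b ^ i))" for c :: "nat \<Rightarrow> nat"
    by (rule sum.cong)
      (auto simp: geometric_gens_def lessThan_Suc_atMost[symmetric] nth_map_upt simp del: upt_Suc)
  then show ?thesis by (simp add: semigroup_gen_def)
qed

text \<open>Exchanging \<open>a\<close> and \<open>b\<close> reverses the list of generators. This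
  gives the case of even \<open>a\<close>.\<close>

lemma semigroup_gen_geometric_gens_commute:
  "semigroup_gen (geometric_gens a b k) = semigroup_gen (geometric_gens b a k)"
proof -
  have "semigroup_gen (geometric_gens a b k) \<subseteq> semigroup_gen (geometric_gens b a k)" for a b
  proof
    fix x assume "x \<in> semigroup_gen (geometric_gens a b k)"
    then obtain c where "x = (\<Sum>i\<le>k. c i * (a ^ (k - i) * b ^ i))"
      by (auto simp: semigroup_gen_geometric_gens)
    also have "\<dots> = (\<Sum>i\<le>k. c (k - i) * (b ^ (k - i) * a ^ i))"
      by (rule sum.reindex_bij_witness[of _ "\<lambda>i. k - i" "\<lambda>i. k - i"]) auto
    finally show "x \<in> semigroup_gen (geometric_gens b a k)"
      unfolding semigroup_gen_geometric_gens by (auto intro!: exI[of _ "\<lambda>i. c (k - i)"])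
  qed
  then show ?thesis by blast
qed

text \<open>Every generator for \<open>Suc k\<close> except the last is \<open>a\<close> times a
  generator for \<open>k\<close>. The induction for the Apery set runs on this recursion.\<close>

lemma semigroup_gen_geometric_gens_Suc:
  "semigroup_gen (geometric_gens a b (Suc k)) =
     {a * s + b ^ Suc k * c | s c. s \<in> semigroup_gen (geometric_gens a b k)}"
proof -
  have split: "(\<Sum>i\<le>Suc k. c i * (a ^ (Suc k - i) * b ^ i))
      = a * (\<Sum>i\<le>k. c i * (a ^ (k - i) * b ^ i)) + b ^ Suc k * c (Suc k)" for c
  proof -
    have "(\<Sum>i\<le>k. c i * (a ^ (Suc k - i) * b ^ i)) = (\<Sum>i\<le>k. a * (c i * (a ^ (k - i) * b ^ i)))"
      by (rule sum.cong) (auto simp: Suc_diff_le algebra_simps)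
    then show ?thesis by (simp add: sum_distrib_left algebra_simps)
  qed
  show ?thesis
  proof (intro equalityI subsetI)
    fix x assume "x \<in> semigroup_gen (geometric_gens a b (Suc k))"
    then show "x \<in> {a * s + b ^ Suc k * c | s c. s \<in> semigroup_gen (geometric_gens a b k)}"
      unfolding semigroup_gen_geometric_gens using split by blast
  next
    fix x assume "x \<in> {a * s + b ^ Suc k * c | s c. s \<in> semigroup_gen (geometric_gens a b k)}"
    then obtain d c where x: "x = a * (\<Sum>i\<le>k. d i * (a ^ (k - i) * b ^ i)) + b ^ Suc k * c"
      unfolding semigroup_gen_geometric_gens by blast
    have "x = (\<Sum>i\<le>Suc k. (d(Suc k := c)) i * (a ^ (Suc k - i) * b ^ i))"
      unfolding split x by simp
    then show "x \<in> semigroup_gen (geometric_gens a b (Suc k))"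
      unfolding semigroup_gen_geometric_gens by blast
  qed
qed

text \<open>The coefficient of \<open>b\<^bsup>k+1\<^esup>\<close> can be reduced modulo \<open>a\<close> because \<open>a b\<^bsup>k+1\<^esup> = b (a b\<^sup>k)\<close>.\<close>

lemma semigroup_gen_geometric_gens_Suc_reduced:
  assumes "a > 0"
  shows "semigroup_gen (geometric_gens a b (Suc k)) =
     {a * s + b ^ Suc k * c | s c. s \<in> semigroup_gen (geometric_gens a b k) \<and> c < a}"
    (is "_ = ?R")
proof
  show "?R \<subseteq> semigroup_gen (geometric_gens a b (Suc k))"
    unfolding semigroup_gen_geometric_gens_Suc by blast
  show "semigroup_gen (geometric_gens a b (Suc k)) \<subseteq> ?R"
  proof
    fix x assume "x \<in> semigroup_gen (geometric_gens a b (Suc k))"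
    then obtain s c where s: "s \<in> semigroup_gen (geometric_gens a b k)"
      and x: "x = a * s + b ^ Suc k * c"
      unfolding semigroup_gen_geometric_gens_Suc by blast
    have "length (geometric_gens a b k) = Suc k" "geometric_gens a b k ! k = b ^ k"
      by (simp_all add: geometric_gens_def nth_append)
    \<comment> \<open>With \<open>c = c div a * a + c mod a\<close>, the part
      \<open>b ^ Suc k * (c div a * a)\<close> is \<open>a\<close> times this element.\<close>
    then have "(b * (c div a)) * b ^ k \<in> semigroup_gen (geometric_gens a b k)"
      using semigroup_gen_mult[of k "geometric_gens a b k"] by simp
    then have "s + b * (c div a) * b ^ k \<in> semigroup_gen (geometric_gens a b k)"
      using s semigroup_gen_add by blast
    moreover have "x = a * (s + b * (c div a) * b ^ k) + b ^ Suc k * (c mod a)"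
    proof -
      have "x = a * s + b ^ Suc k * (c div a * a + c mod a)" using x by simp
      then show ?thesis by (simp only: algebra_simps power_Suc)
    qed
    moreover have "c mod a < a" using assms by simp
    ultimately show "x \<in> ?R" by blast
  qed
qed

section \<open>The Apery set of a geometric semigroup\<close>

text \<open>Passing to integers avoids truncated subtraction in the divisibility argument
  below.\<close>

lemma nat_mod_eq_iff_int_dvd:
  fixes x y m :: nat
  shows "x mod m = y mod m \<longleftrightarrow> int m dvd int x - int y"
  by (metis mod_eq_dvd_iff of_nat_eq_iff zmod_int)

text \<open>Modulo \<open>a\<close> the term \<open>a * w\<close> vanishes, so coprimality and
  \<open>c < a\<close> determine \<open>c\<close>; cancelling \<open>a\<close> then leaves a
  congruence modulo \<open>m\<close>, which determines \<open>w\<close>.\<close>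

lemma inj_on_scaled_add_mod:
  fixes a B m :: nat
  assumes "coprime a B" "a > 0" "inj_on (\<lambda>w. w mod m) A"
  shows "inj_on (\<lambda>(w, c). (a * w + B * c) mod (a * m)) (A \<times> {..<a})"
proof (rule inj_onI, clarify)
  fix w c w' c'
  assume w: "w \<in> A" "w' \<in> A" and c: "c < a" "c' < a"
    and eq: "(a * w + B * c) mod (a * m) = (a * w' + B * c') mod (a * m)"
  have "int (a * m) dvd int (a * w + B * c) - int (a * w' + B * c')"
    using eq by (simp only: nat_mod_eq_iff_int_dvd)
  also have "int (a * w + B * c) - int (a * w' + B * c')
      = int a * (int w - int w') + int B * (int c - int c')"
    by (simp add: algebra_simps)
  finally have int_eq: "int a * int m dvd int a * (int w - int w') + int B * (int c - int c')"
    by simp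
  then have "int a dvd int a * (int w - int w') + int B * (int c - int c')"
    by (rule dvd_mult_left)
  then have "int a dvd int B * (int c - int c')"
    by (simp add: dvd_add_right_iff)
  then have "int a dvd int c - int c'"
    using assms(1) by (simp add: coprime_dvd_mult_right_iff)
  then have "c mod a = c' mod a"
    by (simp only: nat_mod_eq_iff_int_dvd)
  then have cc: "c = c'" using c by simp
  then have "int m dvd int w - int w'"
    using int_eq assms(2) by simp
  then have "w mod m = w' mod m"
    by (simp only: nat_mod_eq_iff_int_dvd)
  then show "w = w' \<and> c = c'"
    using cc w assms(3) by (auto simp: inj_on_def)
qed

text \<open>Set and sum are built in one induction: the new set consists of
  \<open>a * w + b ^ Suc k * c\<close> with \<open>w\<close> in the old one and
  \<open>c < a\<close>, so the sum gains one factor per step.\<close>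

lemma apery_set_geometric:
  assumes "coprime a b" "odd a"
  shows "\<exists>A. apery_set (semigroup_gen (geometric_gens a b k)) (a ^ k) A \<and>
    (\<Sum>w\<in>A. (-1::int) ^ w) = (if even b then int a ^ k else 1)"
proof (induction k)
  \<comment> \<open>The only generator is 1 and the modulus is 1.\<close>
  case 0
  have "semigroup_gen (geometric_gens a b 0) = UNIV"
    unfolding semigroup_gen_geometric_gens by auto
  then have "apery_set (semigroup_gen (geometric_gens a b 0)) (a ^ 0) {0}"
    by (auto simp: apery_set_def bij_betw_def)
  then show ?case by (intro exI[of _ "{0}"]) auto
next
  case (Suc k)
  have a: "a > 0" using assms(2) by (cases a) auto
  obtain A where A: "apery_set (semigroup_gen (geometric_gens a b k)) (a ^ k) A"
    and sumA: "(\<Sum>w\<in>A. (-1::int) ^ w) = (if even b then int a ^ k else 1)"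
    using Suc.IH by blast
  have bij: "bij_betw (\<lambda>w. w mod a ^ k) A {..<a ^ k}"
    and gen: "semigroup_gen (geometric_gens a b k) = {w + j * a ^ k | w j. w \<in> A}"
    using A by (auto simp: apery_set_def)
  define f where "f = (\<lambda>(w, c). a * w + b ^ Suc k * c)"
  define A' where "A' = f ` (A \<times> {..<a})"
  have "coprime a (b ^ Suc k)" using assms(1) by simp
  then have inj: "inj_on (\<lambda>p. f p mod a ^ Suc k) (A \<times> {..<a})"
    using inj_on_scaled_add_mod[of a "b ^ Suc k" "a ^ k" A] a bij
    by (simp add: f_def bij_betw_def case_prod_unfold)
  have inj_f: "inj_on f (A \<times> {..<a})"
    using inj by (auto simp: inj_on_def)
  have inj_mod: "inj_on (\<lambda>w. w mod a ^ Suc k) A'"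
    using inj unfolding A'_def by (auto simp: inj_on_def)
  \<comment> \<open>Surjectivity onto the residues comes from counting: \<open>a * a ^ k\<close>
    distinct residues modulo \<open>a ^ Suc k\<close> are all of them.\<close>
  have "card A' = a ^ Suc k"
    using bij_betw_same_card[OF bij] by (simp add: A'_def card_image[OF inj_f] card_cartesian_product)
  then have "(\<lambda>w. w mod a ^ Suc k) ` A' = {..<a ^ Suc k}"
    using a by (intro card_subset_eq) (auto simp: card_image[OF inj_mod] simp del: power_Suc)
  then have bij': "bij_betw (\<lambda>w. w mod a ^ Suc k) A' {..<a ^ Suc k}"
    using inj_mod by (simp add: bij_betw_def)
  have "semigroup_gen (geometric_gens a b (Suc k)) = {w + j * a ^ Suc k | w j. w \<in> A'}"
  proof (intro equalityI subsetI)
    fix x assume "x \<in> semigroup_gen (geometric_gens a b (Suc k))"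
    then obtain w j c where "w \<in> A" "c < a" "x = a * (w + j * a ^ k) + b ^ Suc k * c"
      unfolding semigroup_gen_geometric_gens_Suc_reduced[OF a] gen by blast
    then have "f (w, c) \<in> A'" "x = f (w, c) + j * a ^ Suc k"
      unfolding A'_def by blast (simp add: \<open>x = _\<close> f_def algebra_simps)
    then show "x \<in> {w + j * a ^ Suc k | w j. w \<in> A'}" by blast
  next
    fix x assume "x \<in> {w + j * a ^ Suc k | w j. w \<in> A'}"
    then obtain w c j where "w \<in> A" "c < a" "x = a * w + b ^ Suc k * c + j * a ^ Suc k"
      by (auto simp: A'_def f_def)
    then have "x = a * (w + j * a ^ k) + b ^ Suc k * c" "w \<in> A"
      by (auto simp: algebra_simps)
    then show "x \<in> semigroup_gen (geometric_gens a b (Suc k))"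
      unfolding semigroup_gen_geometric_gens_Suc gen by blast
  qed
  then have "apery_set (semigroup_gen (geometric_gens a b (Suc k))) (a ^ Suc k) A'"
    using bij' by (simp add: apery_set_def)
  moreover have "(\<Sum>w\<in>A'. (-1::int) ^ w) = (if even b then int a ^ Suc k else 1)"
  proof -
    \<comment> \<open>As \<open>a\<close> is odd, \<open>a * w\<close> has the parity of
      \<open>w\<close>; as the exponent \<open>Suc k\<close> is positive, \<open>b ^ Suc k\<close>
      has the parity of \<open>b\<close>.\<close>
    have sign: "(-1::int) ^ f (w, c) = (-1) ^ w * (if even b then 1 else (-1) ^ c)" for w c
      using assms(2) by (simp add: f_def power_add uminus_power_if)
    have factor: "(\<Sum>c<a. if even b then 1 else (-1::int) ^ c) = (if even b then int a else 1)"
      using sum_alternating_lessThan[of a] assms(2) by simp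
    have "(\<Sum>w\<in>A'. (-1::int) ^ w) = (\<Sum>p\<in>A \<times> {..<a}. (-1) ^ f p)"
      by (simp add: A'_def sum.reindex[OF inj_f])
    also have "\<dots> = (\<Sum>w\<in>A. \<Sum>c<a. (-1) ^ w * (if even b then 1 else (-1) ^ c))"
      by (simp only: sum.cartesian_product sign[symmetric]) (simp add: case_prod_unfold)
    also have "\<dots> = (\<Sum>w\<in>A. (-1) ^ w) * (if even b then int a else 1)"
      by (simp only: sum_distrib_left[symmetric] factor sum_distrib_right[symmetric])
    finally show ?thesis using sumA by simp
  qed
  ultimately show ?case by blast
qed

section \<open>From alternating sums to parity counts\<close>

lemma odd_count_diff_even_count:
  assumes "finite X"
  shows "real (odd_count X) - real (even_count X) = - real_of_int (\<Sum>n\<in>X. (-1) ^ n)"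
proof -
  have "X = {x \<in> X. odd x} \<union> {x \<in> X. even x}" by blast
  then have "(\<Sum>n\<in>X. (-1::int) ^ n) = (\<Sum>n\<in>{x \<in> X. odd x} \<union> {x \<in> X. even x}. (-1) ^ n)"
    by simp
  also have "\<dots> = (\<Sum>n\<in>{x \<in> X. odd x}. (-1) ^ n) + (\<Sum>n\<in>{x \<in> X. even x}. (-1) ^ n)"
    using assms by (intro sum.union_disjoint) auto
  \<comment> \<open>Odd elements contribute -1, hence the minus sign in the conclusion.\<close>
  also have "\<dots> = int (even_count X) - int (odd_count X)"
    by (simp add: odd_count_def even_count_def)
  finally show ?thesis by simp
qed

lemma odd_count_diff_even_count_geometric:
  assumes "geometric_numerical_semigroup a b k S" "odd a"
  shows "real (odd_count (gaps S)) - real (even_count (gaps S))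
    = (if even b then (real a ^ k - 1) / 2 else 0)"
proof -
  have "coprime a b" and S: "S = semigroup_gen (geometric_gens a b k)"
    using assms(1) by (auto simp: geometric_numerical_semigroup_def)
  then obtain A where A: "apery_set S (a ^ k) A"
    and sumA: "(\<Sum>w\<in>A. (-1::int) ^ w) = (if even b then int a ^ k else 1)"
    using apery_set_geometric[OF _ assms(2), of b k] by blast
  have "finite (gaps S)"
    using geometric_numerical_semigroup_imp_numerical_semigroup[OF assms(1)]
    by (simp add: numerical_semigroup_def gaps_def)
  then have diff: "real (odd_count (gaps S)) - real (even_count (gaps S))
      = - real_of_int (\<Sum>n\<in>gaps S. (-1) ^ n)"
    by (rule odd_count_diff_even_count)
  \<comment> \<open>The modulus \<open>a ^ k\<close> is odd because \<open>a\<close> is.\<close>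
  have "2 * (\<Sum>n\<in>gaps S. (-1::int) ^ n) = 1 - (if even b then int a ^ k else 1)"
    using alternating_sum_gaps_apery[OF A] assms(2) sumA by simp
  then have "2 * real_of_int (\<Sum>n\<in>gaps S. (-1) ^ n) = 1 - (if even b then real a ^ k else 1)"
    by (auto dest!: arg_cong[where f = real_of_int] split: if_splits)
  then show ?thesis using diff by (auto split: if_splits)
qed

theorem corollary3p13:
  fixes a b k :: nat and S :: "nat set"
  assumes "geometric_numerical_semigroup a b k S"
  shows "(odd a \<or> odd b) \<and>
    (odd a \<and> odd b \<longrightarrow>
       real (odd_count (gaps S)) - real (even_count (gaps S)) = 0) \<and>
    (odd a \<and> even b \<longrightarrow>
       real (odd_count (gaps S)) - real (even_count (gaps S)) = (real a ^ k - 1) / 2) \<and>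
    (even a \<and> odd b \<longrightarrow>
       real (odd_count (gaps S)) - real (even_count (gaps S)) = (real b ^ k - 1) / 2)"
proof -
  \<comment> \<open>The same \<open>S\<close> with the roles exchanged, so that the odd parameter
    comes first when \<open>a\<close> is even.\<close>
  have "geometric_numerical_semigroup b a k S"
    using assms semigroup_gen_geometric_gens_commute[of a b k]
    by (simp add: geometric_numerical_semigroup_def coprime_commute)
  moreover have "odd a \<or> odd b"
    using assms by (auto simp: geometric_numerical_semigroup_def dest: coprime_common_divisor_nat)
  ultimately show ?thesis
    using odd_count_diff_even_count_geometric[OF assms]
      odd_count_diff_even_count_geometric[of b a k S]
    by simp
qed

end
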